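(* For all $k,s,t\in\mathbb{N}$, every bipartite graph $G$ that has a 2-layer drawing with no $(k+1)$-crossing and no $(s,t)$-crossing has pathwidth at most $$8k^2(t-1)+4k^2(s-1)^2(s-2)+5k+4.$$
   Context: $\mathbb{N}=\{1,2,3,\dots\}$ denotes the positive integers. Graphs are finite and simple. A 2-layer drawing of a bipartite graph $G$ with bipartition $\{A,B\}$ positions the vertices in $A$ at distinct points on a horizontal line, positions the vertices in $B$ at distinct points on a different horizontal line, and draws each edge as a straight line-segment. Equivalently, it is given by total orders $\preceq_A$ on $A$ and $\preceq_B$ on $B$ (left-to-right orders); two edges $vw$ and $xy$ with $v,x\in A$ and $w,y\in B$ cross if and only if ($v\prec_A x$ and $y\prec_B w$) or ($x\prec_A v$ and $w\prec_B y$). In particular, edges sharing an end-vertex do not cross. A matching in a graph is a set of edges, no two of which are incident to a common vertex; a $k$-matching is a matching of size $k$. In a 2-layer drawing, a $k$-crossing is a set of $k$ pairwise crossing edges (necessarily a $k$-matching). A set of edges in a 2-layer drawing is non-crossing if no two edges in it cross. In a 2-layer drawing, an $(s,t)$-crossing is a pair $(S,T)$ where $S$ is a non-crossing $s$-matching, $T$ is a non-crossing $t$-matching, and every edge in $S$ crosses every edge in $T$. A path-decomposition of a graph $G$ is a sequence $(B_1,\dots,B_n)$ of subsets of $V(G)$ (called bags) such that $B_1\cup\dots\cup B_n=V(G)$, both end-vertices of each edge of $G$ lie in a common bag, and $B_i\cap B_k\subseteq B_j$ whenever $1\leq i<j<k\leq n$. Its width is $\max_i|B_i|-1$. The pathwidth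 of $G$ is the minimum width of a path-decomposition of $G$. *)

theory Defs
  imports Main
begin

text \<open>A graph is given by its vertex set \<open>V\<close> and its set \<open>E\<close> of edges, an edge being
  the set of its two end-vertices.\<close>

definition finite_simple_graph :: "'a set \<Rightarrow> 'a set set \<Rightarrow> bool" where
  "finite_simple_graph V E \<longleftrightarrow> finite V \<and> (\<forall>e\<in>E. e \<subseteq> V \<and> card e = 2)"

definition bipartition :: "'a set \<Rightarrow> 'a set set \<Rightarrow> 'a set \<Rightarrow> 'a set \<Rightarrow> bool" where
  "bipartition V E A B \<longleftrightarrow>
     A \<union> B = V \<and> A \<inter> B = {} \<and> (\<forall>e\<in>E. \<exists>v\<in>A. \<exists>w\<in>B. e = {v, w})"

definition matching :: "'a set set \<Rightarrow> 'a set set \<Rightarrow> bool" where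
  "matching E M \<longleftrightarrow> M \<subseteq> E \<and> pairwise disjnt M"

text \<open>A drawing is determined by the (reflexive) left-to-right orders \<open>rA\<close> and \<open>rB\<close> of the
  two layers; either layer may be empty.\<close>

definition two_layer_drawing ::
  "'a set \<Rightarrow> 'a set set \<Rightarrow> 'a set \<Rightarrow> 'a set \<Rightarrow> 'a rel \<Rightarrow> 'a rel \<Rightarrow> bool" where
  "two_layer_drawing V E A B rA rB \<longleftrightarrow>
     bipartition V E A B \<and> linear_order_on A rA \<and> linear_order_on B rB"

definition strictly_before :: "'a rel \<Rightarrow> 'a \<Rightarrow> 'a \<Rightarrow> bool" where
  "strictly_before r x y \<longleftrightarrow> (x, y) \<in> r \<and> x \<noteq> y"

definition edges_cross ::
  "'a set \<Rightarrow> 'a set \<Rightarrow> 'a rel \<Rightarrow> 'a rel \<Rightarrow> 'a set \<Rightarrow> 'a set \<Rightarrow> bool" where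
  "edges_cross A B rA rB e f \<longleftrightarrow>
     (\<exists>v\<in>A. \<exists>w\<in>B. \<exists>x\<in>A. \<exists>y\<in>B. e = {v, w} \<and> f = {x, y} \<and>
        (strictly_before rA v x \<and> strictly_before rB y w \<or>
         strictly_before rA x v \<and> strictly_before rB w y))"

definition non_crossing ::
  "'a set \<Rightarrow> 'a set \<Rightarrow> 'a rel \<Rightarrow> 'a rel \<Rightarrow> 'a set set \<Rightarrow> bool" where
  "non_crossing A B rA rB M \<longleftrightarrow> (\<forall>e\<in>M. \<forall>f\<in>M. \<not> edges_cross A B rA rB e f)"

definition is_k_crossing ::
  "'a set set \<Rightarrow> 'a set \<Rightarrow> 'a set \<Rightarrow> 'a rel \<Rightarrow> 'a rel \<Rightarrow> nat \<Rightarrow> 'a set set \<Rightarrow> bool" where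
  "is_k_crossing E A B rA rB k M \<longleftrightarrow>
     M \<subseteq> E \<and> finite M \<and> card M = k \<and> pairwise (edges_cross A B rA rB) M"

definition is_st_crossing ::
  "'a set set \<Rightarrow> 'a set \<Rightarrow> 'a set \<Rightarrow> 'a rel \<Rightarrow> 'a rel \<Rightarrow> nat \<Rightarrow> nat \<Rightarrow>
     'a set set \<Rightarrow> 'a set set \<Rightarrow> bool" where
  "is_st_crossing E A B rA rB s t S T \<longleftrightarrow>
     matching E S \<and> finite S \<and> card S = s \<and> non_crossing A B rA rB S \<and>
     matching E T \<and> finite T \<and> card T = t \<and> non_crossing A B rA rB T \<and>
     (\<forall>e\<in>S. \<forall>f\<in>T. edges_cross A B rA rB e f)"

definition path_decomposition :: "'a set \<Rightarrow> 'a set set \<Rightarrow> 'a set list \<Rightarrow> bool" where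
  "path_decomposition V E Bs \<longleftrightarrow>
     Bs \<noteq> [] \<and> \<Union>(set Bs) = V \<and>
     (\<forall>e\<in>E. \<exists>X\<in>set Bs. e \<subseteq> X) \<and>
     (\<forall>i j k. i < j \<longrightarrow> j < k \<longrightarrow> k < length Bs \<longrightarrow> Bs ! i \<inter> Bs ! k \<subseteq> Bs ! j)"

text \<open>Widths are integers: the graph without vertices has pathwidth \<open>-1\<close>.\<close>

definition pd_width :: "'a set list \<Rightarrow> int" where
  "pd_width Bs = Max ((\<lambda>X. int (card X)) ` set Bs) - 1"

text \<open>For a finite graph the minimum exists: widths are at least \<open>-1\<close>, and \<open>[V]\<close> is a
  path-decomposition.\<close>

definition pathwidth :: "'a set \<Rightarrow> 'a set set \<Rightarrow> int" where
  "pathwidth V E = (LEAST w. \<exists>Bs. path_decomposition V E Bs \<and> pd_width Bs = w)"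

end

theory Submission
  imports Defs
begin

text \<open>Sweep a cut through the drawing from left to right, adding one vertex at a time to a set
  \<open>P\<close> that is an initial segment of both layers. An edge leaving \<open>P\<close> from its end in \<open>A\<close> crosses
  every edge leaving \<open>P\<close> from its end in \<open>B\<close>. If both kinds contained matchings of more than
  \<open>k (max s t - 1)\<close> edges, then, as there is no \<open>(k + 1)\<close>-crossing, both would contain non-crossing
  matchings of \<open>max s t\<close> edges, hence an \<open>(s, t)\<close>-crossing. Choosing the layer of the next vertex
  greedily keeps the two matching numbers within 2 of each other, so the edges leaving \<open>P\<close> always
  have matching number at most \<open>2 k (max s t - 1) + 2\<close>. By Koenig's theorem they have a vertex
  cover of that size, and suitably chosen covers of consecutive cuts are the bags of a
  path-decomposition of width at most \<open>4 k (max s t - 1) + 4\<close>.\<close>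

section \<open>Koenig's theorem: vertex covers and matchings in bipartite graphs\<close>

text \<open>In an edge set that is minimal with given vertex cover number, two edges sharing a vertex
  would allow two smaller covers to be uncrossed, so it is a matching.\<close>

lemma koenig_matching:
  assumes "finite F" and "P \<inter> Q = {}"
    and "\<And>e. e \<in> F \<Longrightarrow> \<exists>x\<in>P. \<exists>y\<in>Q. e = {x, y}"
    and "\<And>C. finite C \<Longrightarrow> \<forall>e\<in>F. e \<inter> C \<noteq> {} \<Longrightarrow> c \<le> card C"
  shows "\<exists>M\<subseteq>F. pairwise disjnt M \<and> c \<le> card M"
  using assms
proof (induction "card F" arbitrary: F rule: less_induct)
  case less
  show ?case
  \<comment> \<open>An edge whose deletion keeps the cover number at least \<open>c\<close> is
    deleted. Otherwise every edge is critical: all other edges have a cover with fewer than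
    \<open>c\<close> vertices.\<close>
  proof (cases "\<exists>e\<in>F. \<forall>C. finite C \<longrightarrow> (\<forall>e'\<in>F - {e}. e' \<inter> C \<noteq> {}) \<longrightarrow> c \<le> card C")
    case True
    then obtain e where e: "e \<in> F"
      and c: "\<And>C. finite C \<Longrightarrow> \<forall>e'\<in>F - {e}. e' \<inter> C \<noteq> {} \<Longrightarrow> c \<le> card C"
      by blast
    have "\<exists>M\<subseteq>F - {e}. pairwise disjnt M \<and> c \<le> card M"
    proof (rule less.hyps)
      show "card (F - {e}) < card F"
        using e less.prems(1) by (rule card_Diff1_less[rotated])
    qed (use less.prems c in auto)
    then show ?thesis by blast
  next
    case False
    then have critical: "\<exists>C. finite C \<and> (\<forall>e'\<in>F - {e}. e' \<inter> C \<noteq> {}) \<and> card C < c"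
      if "e \<in> F" for e
      using that by (meson not_le)
    have "disjnt e f" if e: "e \<in> F" and f: "f \<in> F" and "e \<noteq> f" for e f
    proof (rule ccontr)
      assume "\<not> disjnt e f"
      then obtain x where x: "x \<in> e" "x \<in> f" by (auto simp: disjnt_def)
      obtain C1 where C1: "finite C1" "\<forall>e'\<in>F - {e}. e' \<inter> C1 \<noteq> {}" "card C1 < c"
        using critical[OF e] by blast
      obtain C2 where C2: "finite C2" "\<forall>e'\<in>F - {f}. e' \<inter> C2 \<noteq> {}" "card C2 < c"
        using critical[OF f] by blast
      \<comment> \<open>The two sides are kept variable because the shared vertex \<open>x\<close>
        may lie in either of them.\<close>
      have uncross: False
        if PQ: "P' \<inter> Q' = {}" and edges: "\<And>e. e \<in> F \<Longrightarrow> \<exists>x\<in>P'. \<exists>y\<in>Q'. e = {x, y}"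
          and xP: "x \<in> P'" for P' Q'
      proof -
        \<comment> \<open>\<open>D\<close> and \<open>D' - {x}\<close> together have at most
          \<open>card C1 + card C2\<close>, hence at most \<open>2 * c - 2\<close>, elements. Both
          \<open>D\<close> and \<open>D'\<close> turn out to cover \<open>F\<close>, which would
          require at least \<open>2 * c - 1\<close>.\<close>
        define D where "D = (C1 \<inter> C2 \<inter> P') \<union> (C1 \<union> C2) \<inter> Q'"
        define D' where "D' = insert x (((C1 \<union> C2) \<inter> P') \<union> (C1 \<inter> C2 \<inter> Q'))"
        obtain y where y: "e = {x, y}" "y \<in> Q'" using edges[OF e] x PQ xP by blast
        obtain z where z: "f = {x, z}" "z \<in> Q'" using edges[OF f] x PQ xP by blast
        have "\<not> (\<forall>e'\<in>F. e' \<inter> C1 \<noteq> {})" using less.prems(4)[OF C1(1)] C1(3) by force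
        then have "e \<inter> C1 = {}" using C1(2) by blast
        moreover have "f \<inter> C1 \<noteq> {}" using C1(2) f \<open>e \<noteq> f\<close> by simp
        ultimately have z1: "z \<in> C1" using x z(1) by auto
        have "\<not> (\<forall>e'\<in>F. e' \<inter> C2 \<noteq> {})" using less.prems(4)[OF C2(1)] C2(3) by force
        then have "f \<inter> C2 = {}" using C2(2) by blast
        moreover have "e \<inter> C2 \<noteq> {}" using C2(2) e \<open>e \<noteq> f\<close> by simp
        ultimately have y2: "y \<in> C2" using x y(1) by auto
        \<comment> \<open>The edges \<open>e\<close> and \<open>f\<close>, which \<open>C1\<close>
          and \<open>C2\<close> miss respectively, meet \<open>D\<close> in \<open>y\<close> and
          \<open>z\<close>, and \<open>D'\<close> in \<open>x\<close>.\<close>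
        have covD: "e' \<inter> D \<noteq> {} \<and> e' \<inter> D' \<noteq> {}" if e': "e' \<in> F" for e'
        proof (cases "e' = e \<or> e' = f")
          case True
          then show ?thesis using y z y2 z1 by (auto simp: D_def D'_def)
        next
          case False
          obtain p q where pq: "p \<in> P'" "q \<in> Q'" "e' = {p, q}" using edges[OF e'] by blast
          have "e' \<inter> C1 \<noteq> {}" "e' \<inter> C2 \<noteq> {}" using C1(2) C2(2) e' False by simp_all
          then have "p \<in> C1 \<or> q \<in> C1" "p \<in> C2 \<or> q \<in> C2" using pq(3) by auto
          then show ?thesis using pq by (auto simp: D_def D'_def)
        qed
        have fin: "finite D" "finite D'" using C1(1) C2(1) by (auto simp: D_def D'_def)
        have "c \<le> card D" "c \<le> card D'" using less.prems(4) covD fin by auto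
        moreover have "Suc (card (D' - {x})) = card D'"
          using fin(2) by (rule card_Suc_Diff1) (simp add: D'_def)
        moreover have "card D + card (D' - {x}) \<le> card C1 + card C2"
        proof -
          have "card D + card (D' - {x}) = card (D \<union> (D' - {x})) + card (D \<inter> (D' - {x}))"
            using fin by (intro card_Un_Int) auto
          also have "\<dots> \<le> card (C1 \<union> C2) + card (C1 \<inter> C2)"
            using C1(1) C2(1) PQ by (intro add_mono card_mono) (auto simp: D_def D'_def)
          also have "\<dots> = card C1 + card C2"
            using C1(1) C2(1) by (rule card_Un_Int[symmetric])
          finally show ?thesis .
        qed
        ultimately show False using C1(3) C2(3) by linarith
      qed
      show False
      proof (cases "x \<in> P")
        case True
        then show False using uncross[of P Q] less.prems(2,3) by blast
      next
        case False
        then have "x \<in> Q" using less.prems(3)[OF e] x by blast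
        moreover have "\<exists>x\<in>Q. \<exists>y\<in>P. e = {x, y}" if "e \<in> F" for e
          using less.prems(3)[OF that] by (metis insert_commute)
        ultimately show False using uncross[of Q P] less.prems(2) by blast
      qed
    qed
    then have match: "pairwise disjnt F" by (auto simp: pairwise_def)
    \<comment> \<open>One end of each edge gives a cover, so the matching \<open>F\<close> itself
      has at least \<open>c\<close> edges.\<close>
    obtain h where h: "\<And>e. e \<in> F \<Longrightarrow> h e \<in> e"
      using less.prems(3) by (metis insertI1)
    have "c \<le> card (h ` F)"
      using less.prems(1) h by (intro less.prems(4)) auto
    also have "\<dots> \<le> card F" using less.prems(1) by (rule card_image_le)
    finally show ?thesis using match by blast
  qed
qed

section \<open>Minimum vertex covers of cuts and their monotonicity\<close>

definition neighbours :: "'a set set \<Rightarrow> 'a set \<Rightarrow> 'a set" where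
  "neighbours E D = {y. \<exists>x\<in>D. {x, y} \<in> E}"

text \<open>Every vertex cover of the edges leaving \<open>P\<close> contains one of the form
  \<open>(P - D) \<union> (neighbours E D - P)\<close> with \<open>D \<subseteq> P\<close>.\<close>

definition cut_cover :: "'a set set \<Rightarrow> 'a set \<Rightarrow> 'a set \<Rightarrow> 'a set" where
  "cut_cover E P D = (P - D) \<union> (neighbours E D - P)"

text \<open>Ties between minimum covers are broken towards large \<open>D\<close>; this is what
  makes the choice monotone in \<open>P\<close>.\<close>

definition largest_optimum :: "'a set set \<Rightarrow> 'a set \<Rightarrow> 'a set \<Rightarrow> bool" where
  "largest_optimum E P D \<longleftrightarrow> D \<subseteq> P \<and>
     (\<forall>D'\<subseteq>P. card (cut_cover E P D) \<le> card (cut_cover E P D') \<and>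
       (card (cut_cover E P D') = card (cut_cover E P D) \<longrightarrow> card D' \<le> card D))"

definition cut_edges :: "'a set set \<Rightarrow> 'a set \<Rightarrow> 'a set set" where
  "cut_edges E P = {e \<in> E. \<exists>x\<in>P. \<exists>y. y \<notin> P \<and> e = {x, y}}"

lemma largest_optimum_exists:
  assumes "finite P"
  shows "\<exists>D. largest_optimum E P D"
proof -
  let ?g = "\<lambda>D. card (cut_cover E P D)"
  obtain D0 where D0: "D0 \<subseteq> P" "\<And>D. D \<subseteq> P \<Longrightarrow> ?g D0 \<le> ?g D"
    using ex_has_least_nat[of "\<lambda>D. D \<subseteq> P" "{}" ?g] by auto
  have bound: "\<forall>D. D \<subseteq> P \<and> ?g D = ?g D0 \<longrightarrow> card D < Suc (card P)"
    using assms by (auto simp: less_Suc_eq_le card_mono)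
  obtain D where "D \<subseteq> P \<and> ?g D = ?g D0"
    "\<And>D'. D' \<subseteq> P \<and> ?g D' = ?g D0 \<Longrightarrow> card D' \<le> card D"
    using ex_has_greatest_nat[of "\<lambda>D. D \<subseteq> P \<and> ?g D = ?g D0" D0 card, OF _ bound] D0(1) by blast
  then show ?thesis using D0 unfolding largest_optimum_def by metis
qed

lemma finite_neighbours:
  assumes "finite_simple_graph V E"
  shows "finite (neighbours E D)" and "neighbours E D \<subseteq> V"
proof -
  show sub: "neighbours E D \<subseteq> V"
    using assms by (auto simp: neighbours_def finite_simple_graph_def)
  show "finite (neighbours E D)"
    using finite_subset[OF sub] assms by (auto simp: finite_simple_graph_def)
qed

lemma card_cut_cover:
  assumes "finite_simple_graph V E" "finite P" "D \<subseteq> P"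
  shows "card (cut_cover E P D) + card D = card P + card (neighbours E D - P)"
proof -
  have "card (cut_cover E P D) = card (P - D) + card (neighbours E D - P)"
    unfolding cut_cover_def using assms finite_neighbours(1)[OF assms(1)]
    by (intro card_Un_disjoint) auto
  moreover have "card (P - D) + card D = card P"
    using assms(2,3) by (metis add.commute card_mono card_Diff_subset finite_subset le_add_diff_inverse)
  ultimately show ?thesis by linarith
qed

text \<open>By \<open>card_cut_cover\<close> only the neighbour terms matter, since
  \<open>card D\<close> is modular. Neighbourhoods commute with unions and shrink under
  intersections; as \<open>P\<close> lies in \<open>P'\<close>, the larger set has to go with
  \<open>D \<union> D'\<close>.\<close>

lemma cut_cover_submodular:
  assumes G: "finite_simple_graph V E" and "finite P'" "P \<subseteq> P'" "D \<subseteq> P" "D' \<subseteq> P'"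
  shows "card (cut_cover E P' (D \<union> D')) + card (cut_cover E P (D \<inter> D'))
    \<le> card (cut_cover E P D) + card (cut_cover E P' D')"
proof -
  let ?N = "neighbours E"
  have finP: "finite P" using assms finite_subset by blast
  have finD: "finite D" "finite D'" using assms finP finite_subset by blast+
  note fin = finite_neighbours(1)[OF G]
  have "card (?N (D \<union> D') - P') + card (?N (D \<inter> D') - P)
      = card ((?N (D \<union> D') - P') \<union> (?N (D \<inter> D') - P))
        + card ((?N (D \<union> D') - P') \<inter> (?N (D \<inter> D') - P))"
    using fin by (intro card_Un_Int) auto
  also have "\<dots> \<le> card ((?N D - P) \<union> (?N D' - P')) + card ((?N D - P) \<inter> (?N D' - P'))"
    using fin assms(3) by (intro add_mono card_mono) (auto simp: neighbours_def)
  also have "\<dots> = card (?N D - P) + card (?N D' - P')"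
    using fin by (intro card_Un_Int[symmetric]) auto
  finally have N: "card (?N (D \<union> D') - P') + card (?N (D \<inter> D') - P)
      \<le> card (?N D - P) + card (?N D' - P')" .
  have D: "card D + card D' = card (D \<union> D') + card (D \<inter> D')"
    using finD by (rule card_Un_Int)
  have "D \<union> D' \<subseteq> P'" "D \<inter> D' \<subseteq> P" using assms by auto
  then show ?thesis
    using N D card_cut_cover[OF G assms(2), of "D \<union> D'"] card_cut_cover[OF G finP, of "D \<inter> D'"]
      card_cut_cover[OF G finP assms(4)] card_cut_cover[OF G assms(2,5)]
    by linarith
qed

text \<open>Replacing \<open>D\<close> by \<open>D \<inter> D'\<close> cannot make the cover of
  \<open>P\<close> smaller, so by submodularity \<open>D \<union> D'\<close> is also optimal for
  \<open>P'\<close>. The tie-break then forces \<open>D \<union> D' = D'\<close>.\<close>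

lemma largest_optimum_mono:
  assumes G: "finite_simple_graph V E" and "finite P'" "P \<subseteq> P'"
    and D: "largest_optimum E P D" and D': "largest_optimum E P' D'"
  shows "D \<subseteq> D'"
proof -
  have sub: "D \<subseteq> P" "D' \<subseteq> P'" using D D' by (auto simp: largest_optimum_def)
  have "card (cut_cover E P D) \<le> card (cut_cover E P (D \<inter> D'))"
    using D by (simp add: largest_optimum_def le_infI1)
  then have "card (cut_cover E P' (D \<union> D')) \<le> card (cut_cover E P' D')"
    using cut_cover_submodular[OF G assms(2,3) sub] by linarith
  then have "card (D \<union> D') \<le> card D'"
    using D' sub assms(3) unfolding largest_optimum_def
    by (metis Un_least le_antisym subset_trans)
  moreover have "finite (D \<union> D')"
    using sub assms(2,3) by (meson Un_least finite_subset subset_trans)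
  ultimately have "D' = D \<union> D'" by (intro card_seteq) auto
  then show ?thesis by blast
qed

text \<open>A cover \<open>C\<close> of the cut edges contains the \<open>cut_cover\<close> of
  \<open>P - C\<close>: a cut edge whose end in \<open>P\<close> avoids \<open>C\<close> has its
  other end in \<open>C\<close>. So the optimum is the vertex cover number, and Koenig's theorem
  applies with sides \<open>P\<close> and \<open>- P\<close>.\<close>

lemma largest_optimum_card_le:
  assumes G: "finite_simple_graph V E" and P: "P \<subseteq> V"
    and D: "largest_optimum E P D"
    and M: "\<And>M. M \<subseteq> cut_edges E P \<Longrightarrow> pairwise disjnt M \<Longrightarrow> card M \<le> m"
  shows "card (cut_cover E P D) \<le> m"
proof -
  have finV: "finite V" and EV: "\<And>e. e \<in> E \<Longrightarrow> e \<subseteq> V"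
    using G by (auto simp: finite_simple_graph_def)
  have "E \<subseteq> Pow V" using EV by auto
  then have "finite E" using finV by (meson finite_Pow_iff finite_subset)
  then have fin: "finite (cut_edges E P)" by (simp add: cut_edges_def)
  have "\<exists>M\<subseteq>cut_edges E P. pairwise disjnt M \<and> card (cut_cover E P D) \<le> card M"
  proof (rule koenig_matching[OF fin])
    show "P \<inter> - P = {}" by auto
    show "\<exists>x\<in>P. \<exists>y\<in>- P. e = {x, y}" if "e \<in> cut_edges E P" for e
      using that by (auto simp: cut_edges_def)
    fix C :: "'a set"
    assume C: "finite C" "\<forall>e\<in>cut_edges E P. e \<inter> C \<noteq> {}"
    have "cut_cover E P (P - C) \<subseteq> C"
      using C(2) by (auto simp: cut_cover_def neighbours_def cut_edges_def)
    then have "card (cut_cover E P (P - C)) \<le> card C" using C(1) by (simp add: card_mono)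
    moreover have "card (cut_cover E P D) \<le> card (cut_cover E P (P - C))"
      using D by (auto simp: largest_optimum_def)
    ultimately show "card (cut_cover E P D) \<le> card C" by linarith
  qed
  then show ?thesis using M le_trans by blast
qed

section \<open>Path-decompositions from vertex orderings\<close>

text \<open>\<open>LEAST\<close> over the integers need not be attained, so the minimum is taken
  over naturals \<open>n\<close> with width \<open>int n - 1\<close>, which is possible because a
  list of bags is nonempty and so has width at least -1.\<close>

lemma pathwidth_le:
  assumes pd: "path_decomposition V E Bs" and "pd_width Bs \<le> w"
  shows "pathwidth V E \<le> w"
proof -
  let ?Q = "\<lambda>w. \<exists>Bs. path_decomposition V E Bs \<and> pd_width Bs = w"
  have nat: "\<exists>n. u = int n - 1" if u: "?Q u" for u
  proof -
    obtain Bs where Bs: "path_decomposition V E Bs" "pd_width Bs = u" using u by blast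
    then have "hd Bs \<in> set Bs" by (simp add: path_decomposition_def)
    then have "int (card (hd Bs)) \<le> Max ((\<lambda>X. int (card X)) ` set Bs)" by (intro Max_ge) auto
    then have "-1 \<le> u" using Bs(2) by (simp add: pd_width_def)
    then show ?thesis by (intro exI[of _ "nat (u + 1)"]) auto
  qed
  let ?R = "\<lambda>n. ?Q (int n - 1)"
  obtain n where n: "pd_width Bs = int n - 1" using nat pd by blast
  have R: "?R n" using pd n by auto
  have "pathwidth V E = int (LEAST n. ?R n) - 1"
    unfolding pathwidth_def
  proof (rule Least_equality)
    show "?Q (int (LEAST n. ?R n) - 1)" using R by (rule LeastI)
    fix u assume u: "?Q u"
    then obtain n' where n': "u = int n' - 1" using nat by blast
    then have "(LEAST n. ?R n) \<le> n'" using u by (intro Least_le) auto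
    then show "int (LEAST n. ?R n) - 1 \<le> u" using n' by simp
  qed
  moreover have "(LEAST n. ?R n) \<le> n" using R by (rule Least_le)
  ultimately show ?thesis using n assms(2) by linarith
qed

text \<open>For each initial segment \<open>P i\<close> of the ordering take the optimal vertex cover \<open>K i\<close> of the
  edges leaving \<open>P i\<close>. Since \<open>D\<close> is monotone, each vertex lies in \<open>K i\<close> for an interval of
  indices \<open>i\<close>, so merging consecutive covers gives a path-decomposition.\<close>

lemma pathwidth_le_of_ordering:
  assumes G: "finite_simple_graph V E" and vs: "distinct vs" "set vs = V"
    and M: "\<And>i M. i \<le> length vs \<Longrightarrow> M \<subseteq> cut_edges E (set (take i vs)) \<Longrightarrow>
      pairwise disjnt M \<Longrightarrow> card M \<le> m"
  shows "pathwidth V E \<le> 2 * int m"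
proof (cases "vs = []")
  case True
  \<comment> \<open>The list of bags may not be empty, so the empty graph gets one empty
    bag.\<close>
  have "path_decomposition V E [{}]"
    using G vs True by (auto simp: path_decomposition_def finite_simple_graph_def)
  then show ?thesis by (rule pathwidth_le) (simp add: pd_width_def)
next
  case False
  define n where "n = length vs"
  define P where "P i = set (take i vs)" for i
  have PV: "P i \<subseteq> V" for i using set_take_subset vs(2) by (metis P_def)
  have finP: "finite (P i)" for i by (simp add: P_def)
  have Pmono: "P i \<subseteq> P j" if "i \<le> j" for i j
    using that by (simp add: P_def set_take_subset_set_take)
  have inP: "vs ! j \<in> P i \<longleftrightarrow> j < i" if "j < n" for i j
  proof
    assume "vs ! j \<in> P i"
    then obtain l where "l < i" "l < n" "vs ! l = vs ! j"
      by (auto simp: P_def in_set_conv_nth n_def)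
    then show "j < i" using vs(1) \<open>j < n\<close> by (simp add: n_def nth_eq_iff_index_eq)
  next
    assume "j < i"
    then show "vs ! j \<in> P i" using that by (auto simp: P_def in_set_conv_nth n_def)
  qed
  obtain D where D: "\<And>i. largest_optimum E (P i) (D i)"
    using largest_optimum_exists[OF finP] by metis
  have DP: "D i \<subseteq> P i" for i using D by (auto simp: largest_optimum_def)
  have Dmono: "D i \<subseteq> D j" if "i \<le> j" for i j
    using largest_optimum_mono[OF G finP Pmono[OF that] D D] .
  then have Nmono: "neighbours E (D i) \<subseteq> neighbours E (D j)" if "i \<le> j" for i j
    using that by (fastforce simp: neighbours_def)
  define K where "K i = cut_cover E (P i) (D i)" for i
  have KV: "K i \<subseteq> V" for i
    using PV finite_neighbours(2)[OF G] by (auto simp: K_def cut_cover_def)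
  have cardK: "card (K i) \<le> m" if "i \<le> n" for i
    unfolding K_def using that M
    by (intro largest_optimum_card_le[OF G PV D]) (auto simp: P_def n_def)
  have inK: "vs ! j \<in> K i \<longleftrightarrow>
      (if j < i then vs ! j \<notin> D i else vs ! j \<in> neighbours E (D i))" if "j < n" for i j
    using inP[OF that] DP by (auto simp: K_def cut_cover_def)
  \<comment> \<open>\<open>vs ! i\<close> is the vertex that passes from outside \<open>P i\<close>
    into \<open>P (Suc i)\<close>. Adding it puts every vertex into a bag; the extra 1 in the bag
    size cancels against the -1 in the width.\<close>
  define X where "X i = insert (vs ! i) (K i \<union> K (Suc i))" for i
  define Bs where "Bs = map X [0..<n]"
  have finV: "finite V" using G by (simp add: finite_simple_graph_def)
  have cardX: "card (X i) \<le> 2 * m + 1" if "i < n" for i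
  proof -
    have "card (X i) \<le> Suc (card (K i \<union> K (Suc i)))"
      unfolding X_def by (rule card_insert_le_m1) auto
    also have "\<dots> \<le> Suc (card (K i) + card (K (Suc i)))" using card_Un_le by simp
    finally show ?thesis using cardK[of i] cardK[of "Suc i"] that by simp
  qed
  have n0: "n > 0" using False by (simp add: n_def)
  have "path_decomposition V E Bs"
    unfolding path_decomposition_def
  proof (intro conjI ballI allI impI)
    show "Bs \<noteq> []" using n0 by (simp add: Bs_def)
    have "v \<in> \<Union> (set Bs)" if v: "v \<in> V" for v
    proof -
      obtain i where "i < n" "v = vs ! i" using v vs(2) by (auto simp: in_set_conv_nth n_def)
      then have "v \<in> X i" "X i \<in> set Bs" by (auto simp: X_def Bs_def)
      then show ?thesis by blast
    qed
    moreover have "X i \<subseteq> V" if "i < n" for i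
      using KV that vs(2) nth_mem by (auto simp: X_def n_def)
    ultimately show "\<Union> (set Bs) = V" by (fastforce simp: Bs_def)
  next
    fix e assume e: "e \<in> E"
    have edge: "\<exists>l<n. {vs ! a, vs ! b} \<subseteq> X l"
      if ab: "a < b" "b < n" and E: "{vs ! a, vs ! b} \<in> E" for a b
    proof (cases "vs ! a \<in> D b")
      case False
      then show ?thesis using ab inK[of a b] by (intro exI[of _ b]) (auto simp: X_def)
    next
      case True
      \<comment> \<open>At the moment \<open>l\<close> when \<open>vs ! a\<close> enters
        \<open>D\<close>, it leaves the cover, while \<open>vs ! b\<close>, still outside
        \<open>P l\<close>, is in the cover as its neighbour. The bag merging the covers before and
        after this moment contains both.\<close>
      define l where "l = (LEAST l. vs ! a \<in> D l)"
      have lb: "l \<le> b" unfolding l_def using True by (rule Least_le)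
      have l: "vs ! a \<in> D l" unfolding l_def using True by (rule LeastI)
      then have al: "a < l" using DP inP[of a l] ab by auto
      then obtain l' where l': "l = Suc l'" by (cases l) auto
      have "vs ! a \<notin> D l'" using l' not_less_Least[of l' "\<lambda>l. vs ! a \<in> D l"] by (auto simp: l_def)
      then have "vs ! a \<in> X l'" using al l' inK[of a l'] ab by (auto simp: X_def less_Suc_eq)
      moreover have "vs ! b \<in> neighbours E (D l)" using l E by (auto simp: neighbours_def)
      then have "vs ! b \<in> K l" using inK[of b l] lb ab by auto
      ultimately show ?thesis using l' lb ab by (intro exI[of _ l']) (auto simp: X_def)
    qed
    obtain u v where uv: "e = {u, v}" "u \<noteq> v"
      using G e by (auto simp: finite_simple_graph_def card_2_iff)
    then have "u \<in> set vs" "v \<in> set vs" using G e vs(2) by (auto simp: finite_simple_graph_def)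
    then obtain a b where a: "a < n" "u = vs ! a" and b: "b < n" "v = vs ! b"
      by (auto simp: in_set_conv_nth n_def)
    have "\<exists>l<n. e \<subseteq> X l"
    proof (cases "a < b")
      case True
      then show ?thesis using edge[of a b] e a b uv by simp
    next
      case False
      then have "b < a" using a b uv(2) by (metis linorder_neqE_nat)
      then show ?thesis using edge[of b a] e a b uv by (simp add: insert_commute)
    qed
    then show "\<exists>X\<in>set Bs. e \<subseteq> X" by (auto simp: Bs_def)
  next
    fix i l r :: nat
    assume il: "i < l" and lr: "l < r" and r: "r < length Bs"
    then have rn: "r < n" by (simp add: Bs_def)
    have "X i \<inter> X r \<subseteq> X l"
    proof
      fix v assume v: "v \<in> X i \<inter> X r"
      then have "v \<in> V" using KV rn il lr vs(2) nth_mem by (auto simp: X_def n_def)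
      then obtain j where j: "j < n" "v = vs ! j" using vs(2) by (auto simp: in_set_conv_nth n_def)
      \<comment> \<open>A vertex still outside \<open>P l\<close> is in a cover as a neighbour of
        \<open>D\<close>, and remains one as \<open>D\<close> grows. A vertex already inside is in a
        cover for not being in \<open>D\<close>, so going back to a smaller \<open>D\<close> it was
        in the cover too.\<close>
      consider "j = l" | "l < j" | "j < l" by linarith
      then show "v \<in> X l"
      proof cases
        case 1
        then show ?thesis using j by (simp add: X_def)
      next
        case 2
        then have "vs ! i \<noteq> v"
          using il j vs(1) rn lr by (auto simp: n_def nth_eq_iff_index_eq)
        then have "v \<in> K i \<or> v \<in> K (Suc i)" using v by (auto simp: X_def)
        then have "v \<in> neighbours E (D i) \<or> v \<in> neighbours E (D (Suc i))"
          using inK[OF j(1)] j(2) 2 il by (auto split: if_splits)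
        then have "v \<in> neighbours E (D l)"
          using Nmono[of i l] Nmono[of "Suc i" l] il by auto
        then show ?thesis using inK[OF j(1), of l] j(2) 2 by (simp add: X_def)
      next
        case 3
        then have "vs ! r \<noteq> v"
          using lr j vs(1) rn by (auto simp: n_def nth_eq_iff_index_eq)
        then have "v \<in> K r \<or> v \<in> K (Suc r)" using v by (auto simp: X_def)
        then have "v \<notin> D r \<or> v \<notin> D (Suc r)"
          using inK[OF j(1)] j(2) 3 lr by (auto split: if_splits)
        then have "v \<notin> D l" using Dmono[of l r] Dmono[of l "Suc r"] lr by auto
        then show ?thesis using inK[OF j(1), of l] j(2) 3 by (simp add: X_def)
      qed
    qed
    then show "Bs ! i \<inter> Bs ! r \<subseteq> Bs ! l" using il lr rn by (simp add: Bs_def)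
  qed
  moreover have "pd_width Bs \<le> 2 * int m"
  proof -
    have "Max ((\<lambda>X. int (card X)) ` set Bs) \<le> 2 * int m + 1"
      using n0 cardX by (intro Max.boundedI) (force simp: Bs_def)+
    then show ?thesis by (simp add: pd_width_def)
  qed
  ultimately show ?thesis by (rule pathwidth_le)
qed

section \<open>Chains and antichains in a finite strict order\<close>

text \<open>Mirsky's layering: the minimal elements form an antichain, so removing them costs at
  most \<open>k\<close> elements. The least element of a chain in the rest is not minimal in
  \<open>M\<close>, so the chain extends downwards.\<close>

lemma chain_or_antichain:
  fixes R :: "'b \<Rightarrow> 'b \<Rightarrow> bool"
  assumes "finite M" and R: "transp R" "asymp R"
    and anti: "\<And>N. N \<subseteq> M \<Longrightarrow> \<forall>x\<in>N. \<forall>y\<in>N. \<not> R x y \<Longrightarrow> card N \<le> k"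
    and "k * r < card M"
  shows "\<exists>N\<subseteq>M. card N = Suc r \<and> (\<forall>x\<in>N. \<forall>y\<in>N. x = y \<or> R x y \<or> R y x)"
  using assms(1,4,5)
proof (induction r arbitrary: M)
  case 0
  then have "0 < card M" by simp
  then obtain x where "x \<in> M" by fastforce
  then show ?case by (intro exI[of _ "{x}"]) auto
next
  case (Suc r)
  define M0 where "M0 = {x \<in> M. \<forall>y\<in>M. \<not> R y x}"
  have "card M0 \<le> k" by (rule Suc.prems(2)) (auto simp: M0_def)
  moreover have "card (M - M0) = card M - card M0"
    using Suc.prems(1) by (intro card_Diff_subset) (auto simp: M0_def)
  ultimately have "k * r < card (M - M0)" using Suc.prems(3) by simp
  then obtain N where N: "N \<subseteq> M - M0" "card N = Suc r"
      "\<forall>x\<in>N. \<forall>y\<in>N. x = y \<or> R x y \<or> R y x"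
    using Suc.IH[of "M - M0"] Suc.prems(1,2) by (metis Diff_subset finite_Diff subset_trans)
  have finN: "finite N" "N \<noteq> {}" using N(2) card_ge_0_finite[of N] by auto
  have asym: "\<not> R y x" if "R x y" for x y using R(2) that by (rule asympD)
  have trans: "R x z" if "R x y" "R y z" for x y z using R(1) that by (rule transpD)
  have "asymp_on N R" "transp_on N R" using R by (auto intro: asymp_on_subset transp_on_subset)
  then obtain x where x: "x \<in> N" "\<forall>z\<in>N. z \<noteq> x \<longrightarrow> \<not> R z x"
    using Finite_Set.bex_min_element[OF finN(1) _ _ finN(2)] by blast
  have low: "z = x \<or> R x z" if "z \<in> N" for z using N(3) x that by blast
  obtain y where y: "y \<in> M" "R y x" using x(1) N(1) by (auto simp: M0_def)
  have yN: "R y z" if "z \<in> N" for z using low[OF that] y trans by blast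
  have "y \<notin> N" using yN asym by blast
  then have "card (insert y N) = Suc (Suc r)" using N(2) finN by simp
  moreover have "\<forall>u\<in>insert y N. \<forall>z\<in>insert y N. u = z \<or> R u z \<or> R z u"
    using N(3) yN by blast
  ultimately show ?case using y(1) N(1) by (intro exI[of _ "insert y N"]) auto
qed

section \<open>Matching numbers between two vertex sets\<close>

definition matching_number :: "'a set set \<Rightarrow> 'a set \<Rightarrow> 'a set \<Rightarrow> nat" where
  "matching_number E X Y =
    Max {card M | M. matching E M \<and> (\<forall>e\<in>M. \<exists>x\<in>X. \<exists>y\<in>Y. e = {x, y})}"

lemma finite_matching_cards:
  assumes "finite E"
  shows "finite {card M | M. matching E M \<and> Q M}"
proof (rule finite_subset)
  show "{card M | M. matching E M \<and> Q M} \<subseteq> {..card E}"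
    using assms by (auto simp: matching_def card_mono)
qed simp

lemma matching_number_ge:
  assumes "finite E" "matching E M" "\<And>e. e \<in> M \<Longrightarrow> \<exists>x\<in>X. \<exists>y\<in>Y. e = {x, y}"
  shows "card M \<le> matching_number E X Y"
  unfolding matching_number_def
  using assms by (intro Max_ge finite_matching_cards) blast+

lemma matching_number_attained:
  assumes "finite E"
  shows "\<exists>M. matching E M \<and> (\<forall>e\<in>M. \<exists>x\<in>X. \<exists>y\<in>Y. e = {x, y}) \<and>
    card M = matching_number E X Y"
proof -
  let ?S = "{card M | M. matching E M \<and> (\<forall>e\<in>M. \<exists>x\<in>X. \<exists>y\<in>Y. e = {x, y})}"
  have "matching E {}" by (simp add: matching_def)
  then have "?S \<noteq> {}" by blast
  then have "matching_number E X Y \<in> ?S"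
    unfolding matching_number_def using finite_matching_cards[OF assms] by (intro Max_in)
  then show ?thesis by auto
qed

lemma matching_number_mono:
  assumes "finite E" "X \<subseteq> X'" "Y \<subseteq> Y'"
  shows "matching_number E X Y \<le> matching_number E X' Y'"
proof -
  obtain M where M: "matching E M" "\<And>e. e \<in> M \<Longrightarrow> \<exists>x\<in>X. \<exists>y\<in>Y. e = {x, y}"
    "card M = matching_number E X Y"
    using matching_number_attained[OF assms(1), where X = X and Y = Y] by metis
  have "card M \<le> matching_number E X' Y'"
    using assms M(1,2) by (intro matching_number_ge) blast+
  then show ?thesis using M(3) by simp
qed

lemma matching_number_commute: "matching_number E X Y = matching_number E Y X"
proof -
  have "(\<exists>x\<in>X. \<exists>y\<in>Y. e = {x, y}) \<longleftrightarrow> (\<exists>x\<in>Y. \<exists>y\<in>X. e = {x, y})" for e :: "'a set"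
    by (metis insert_commute)
  then show ?thesis by (simp add: matching_number_def)
qed

lemma matching_number_empty:
  assumes "finite E"
  shows "matching_number E {} Y = 0"
proof -
  obtain M where M: "\<And>e. e \<in> M \<Longrightarrow> \<exists>x\<in>{}. \<exists>y\<in>Y. e = {x, y}"
    "card M = matching_number E {} Y"
    using matching_number_attained[OF assms(1), where X = "{}" and Y = Y] by metis
  then have "M = {}" by blast
  then show ?thesis using M(2) by simp
qed

text \<open>At most one edge of a matching contains \<open>x\<close>; the others run between
  \<open>X\<close> and \<open>Y\<close>.\<close>

lemma matching_number_insert:
  assumes "finite E"
  shows "matching_number E (insert x X) Y \<le> Suc (matching_number E X Y)"
proof -
  obtain M where M: "matching E M" "\<And>e. e \<in> M \<Longrightarrow> \<exists>x'\<in>insert x X. \<exists>y\<in>Y. e = {x', y}"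
    "card M = matching_number E (insert x X) Y"
    using matching_number_attained[OF assms(1), where X = "insert x X" and Y = Y] by metis
  define M' where "M' = {e \<in> M. x \<notin> e}"
  have finM: "finite M" using M(1) assms finite_subset by (auto simp: matching_def)
  have "e = f" if "e \<in> M - M'" "f \<in> M - M'" for e f
    using M(1) that by (auto simp: matching_def pairwise_def disjnt_def M'_def)
  then have "card (M - M') \<le> Suc 0" using finM by (simp add: card_le_Suc0_iff_eq)
  moreover have "card (M - M') = card M - card M'"
    using finM by (intro card_Diff_subset) (auto simp: M'_def)
  moreover have "card M' \<le> matching_number E X Y"
  proof (rule matching_number_ge[OF assms])
    show "matching E M'" using M(1) by (auto simp: matching_def M'_def pairwise_def)
    show "\<exists>x\<in>X. \<exists>y\<in>Y. e = {x, y}" if "e \<in> M'" for e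
      using M(2)[of e] that by (auto simp: M'_def)
  qed
  ultimately show ?thesis using M(3) by linarith
qed

section \<open>Moving one vertex across a cut, and greedy orderings\<close>

lemma linear_order_least:
  assumes "linear_order_on A r" "S \<subseteq> A" "finite S" "S \<noteq> {}"
  obtains v where "v \<in> S" "\<And>u. u \<in> S \<Longrightarrow> u \<noteq> v \<Longrightarrow> strictly_before r v u"
proof -
  have r: "trans r" "antisym r" "total_on A r"
    using assms(1) by (auto simp: linear_order_on_def partial_order_on_def preorder_on_def)
  have "asymp_on S (strictly_before r)"
    using r(2) by (auto simp: asymp_on_def strictly_before_def antisym_def)
  moreover have "transp_on S (strictly_before r)"
    using r(1,2) by (auto simp: transp_on_def strictly_before_def antisym_def trans_def)
  ultimately obtain v where v: "v \<in> S" "\<forall>u\<in>S. u \<noteq> v \<longrightarrow> \<not> strictly_before r u v"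
    using Finite_Set.bex_min_element[OF assms(3) _ _ assms(4)] by blast
  show thesis
  proof (rule that[OF v(1)])
    fix u assume "u \<in> S" "u \<noteq> v"
    then show "strictly_before r v u"
      using v r(3) assms(2) unfolding total_on_def strictly_before_def by blast
  qed
qed


text \<open>\<open>X\<close> and \<open>Y\<close> stand for the two layers in either order. When
  \<open>v\<close> from \<open>Y\<close> joins \<open>P\<close>, it stops being an outer end for
  edges leaving from \<open>X\<close> and becomes an inner end for edges leaving from
  \<open>Y\<close>.\<close>

lemma matching_number_move:
  assumes "finite E" "v \<in> Y - P" "v \<notin> X"
  shows "matching_number E (X \<inter> insert v P) (Y - insert v P) \<le> matching_number E (X \<inter> P) (Y - P)"
    and "matching_number E (X \<inter> P) (Y - P) \<le>
      Suc (matching_number E (X \<inter> insert v P) (Y - insert v P))"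
    and "matching_number E (Y \<inter> P) (X - P) \<le> matching_number E (Y \<inter> insert v P) (X - insert v P)"
    and "matching_number E (Y \<inter> insert v P) (X - insert v P) \<le>
      Suc (matching_number E (Y \<inter> P) (X - P))"
proof -
  have X: "X \<inter> insert v P = X \<inter> P" "X - insert v P = X - P" using assms(3) by auto
  have Y: "Y - P = insert v (Y - insert v P)" "Y \<inter> insert v P = insert v (Y \<inter> P)"
    using assms(2) by auto
  show "matching_number E (X \<inter> insert v P) (Y - insert v P) \<le> matching_number E (X \<inter> P) (Y - P)"
    unfolding X using assms(1) by (intro matching_number_mono) auto
  show "matching_number E (X \<inter> P) (Y - P) \<le>
      Suc (matching_number E (X \<inter> insert v P) (Y - insert v P))"
    unfolding X Y(1) using matching_number_insert[OF assms(1)] by (metis matching_number_commute)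
  show "matching_number E (Y \<inter> P) (X - P) \<le> matching_number E (Y \<inter> insert v P) (X - insert v P)"
    unfolding X using assms(1) by (intro matching_number_mono) auto
  show "matching_number E (Y \<inter> insert v P) (X - insert v P) \<le>
      Suc (matching_number E (Y \<inter> P) (X - P))"
    unfolding X Y(2) by (rule matching_number_insert[OF assms(1)])
qed

text \<open>The greedy scheme behind the sweep: \<open>Q\<close> is the invariant of the prefixes,
  extended one vertex at a time.\<close>

lemma ordering_by_extension:
  assumes "finite V" "Q {}"
    and "\<And>P. P \<subset> V \<Longrightarrow> Q P \<Longrightarrow> \<exists>v\<in>V - P. Q (insert v P)"
  shows "\<exists>vs. distinct vs \<and> set vs = V \<and> (\<forall>i\<le>length vs. Q (set (take i vs)))"
proof -
  have "\<exists>vs. length vs = n \<and> distinct vs \<and> set vs \<subseteq> V \<and> (\<forall>i\<le>n. Q (set (take i vs)))"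
    if "n \<le> card V" for n
    using that
  proof (induction n)
    case 0
    then show ?case using assms(2) by simp
  next
    case (Suc n)
    then obtain vs where vs: "length vs = n" "distinct vs" "set vs \<subseteq> V"
      "\<And>i. i \<le> n \<Longrightarrow> Q (set (take i vs))" by auto
    have "card (set vs) < card V" using vs Suc.prems by (simp add: distinct_card)
    then have "set vs \<subset> V" using vs(3) by auto
    moreover have "Q (set vs)" using vs(1) vs(4)[of n] by simp
    ultimately obtain v where v: "v \<in> V - set vs" "Q (insert v (set vs))"
      using assms(3) by blast
    have "Q (set (take i (vs @ [v])))" if "i \<le> Suc n" for i
      using vs v(2) that by (cases "i = Suc n") simp_all
    then show ?case using vs v(1) by (intro exI[of _ "vs @ [v]"]) simp
  qed
  then obtain vs where vs: "length vs = card V" "distinct vs" "set vs \<subseteq> V"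
    "\<forall>i\<le>card V. Q (set (take i vs))" by blast
  then have "set vs = V" using assms(1) by (intro card_subset_eq) (auto simp: distinct_card)
  then show ?thesis using vs by auto
qed

section \<open>Crossing and precedence of edges in a drawing\<close>

locale drawing =
  fixes V :: "'a set" and E A B rA rB
  assumes graph: "finite_simple_graph V E" and drawing: "two_layer_drawing V E A B rA rB"
begin

lemma finite_V: "finite V" and V_eq: "V = A \<union> B" and disjoint: "A \<inter> B = {}"
  and edge_form: "e \<in> E \<Longrightarrow> \<exists>v\<in>A. \<exists>w\<in>B. e = {v, w}"
  and order_A: "linear_order_on A rA" and order_B: "linear_order_on B rB"
  using graph drawing
  by (auto simp: finite_simple_graph_def two_layer_drawing_def bipartition_def)

lemma finite_E: "finite E"
proof (rule finite_subset)
  show "E \<subseteq> Pow V" using graph by (auto simp: finite_simple_graph_def)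
qed (simp add: finite_V)

text \<open>Edges are unordered pairs; disjointness of the layers makes the end in each layer
  unique, so crossing and precedence can be read off from any representation.\<close>

lemma edge_eq_iff:
  assumes "v \<in> A" "w \<in> B" "x \<in> A" "y \<in> B"
  shows "{v, w} = {x, y} \<longleftrightarrow> v = x \<and> w = y"
  using assms disjoint by (auto simp: doubleton_eq_iff)

abbreviation cross where "cross \<equiv> edges_cross A B rA rB"

abbreviation lessA where "lessA \<equiv> strictly_before rA"

abbreviation lessB where "lessB \<equiv> strictly_before rB"

lemma cross_iff:
  assumes "v \<in> A" "w \<in> B" "x \<in> A" "y \<in> B"
  shows "cross {v, w} {x, y} \<longleftrightarrow> lessA v x \<and> lessB y w \<or> lessA x v \<and> lessB w y"
proof
  assume "cross {v, w} {x, y}"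
  then obtain v' w' x' y' where *: "v' \<in> A" "w' \<in> B" "x' \<in> A" "y' \<in> B"
    "{v, w} = {v', w'}" "{x, y} = {x', y'}"
    "lessA v' x' \<and> lessB y' w' \<or> lessA x' v' \<and> lessB w' y'"
    unfolding edges_cross_def by blast
  then show "lessA v x \<and> lessB y w \<or> lessA x v \<and> lessB w y"
    using edge_eq_iff assms by simp
next
  assume "lessA v x \<and> lessB y w \<or> lessA x v \<and> lessB w y"
  then show "cross {v, w} {x, y}" unfolding edges_cross_def using assms by blast
qed

text \<open>On disjoint edges this strict partial order is the complement of crossing: in a
  matching, chains are non-crossing and antichains are pairwise crossing.\<close>

definition before :: "'a set \<Rightarrow> 'a set \<Rightarrow> bool" where
  "before e f \<longleftrightarrow>
    (\<exists>v\<in>A. \<exists>w\<in>B. \<exists>x\<in>A. \<exists>y\<in>B. e = {v, w} \<and> f = {x, y} \<and> lessA v x \<and> lessB w y)"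

lemma before_iff:
  assumes "v \<in> A" "w \<in> B" "x \<in> A" "y \<in> B"
  shows "before {v, w} {x, y} \<longleftrightarrow> lessA v x \<and> lessB w y"
proof
  assume "before {v, w} {x, y}"
  then obtain v' w' x' y' where *: "v' \<in> A" "w' \<in> B" "x' \<in> A" "y' \<in> B"
    "{v, w} = {v', w'}" "{x, y} = {x', y'}" "lessA v' x' \<and> lessB w' y'"
    unfolding before_def by blast
  then show "lessA v x \<and> lessB w y" using edge_eq_iff assms by simp
next
  assume "lessA v x \<and> lessB w y"
  then show "before {v, w} {x, y}" unfolding before_def using assms by blast
qed

lemma less_trans:
  "lessA x y \<Longrightarrow> lessA y z \<Longrightarrow> lessA x z" "lessB x y \<Longrightarrow> lessB y z \<Longrightarrow> lessB x z"
  and less_asym: "lessA x y \<Longrightarrow> \<not> lessA y x" "lessB x y \<Longrightarrow> \<not> lessB y x"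
  and less_total: "x \<in> A \<Longrightarrow> y \<in> A \<Longrightarrow> x \<noteq> y \<Longrightarrow> lessA x y \<or> lessA y x"
    "x \<in> B \<Longrightarrow> y \<in> B \<Longrightarrow> x \<noteq> y \<Longrightarrow> lessB x y \<or> lessB y x"
proof -
  have r: "trans rA" "antisym rA" "total_on A rA" "trans rB" "antisym rB" "total_on B rB"
    using order_A order_B
    by (auto simp: linear_order_on_def partial_order_on_def preorder_on_def)
  show "lessA x y \<Longrightarrow> lessA y z \<Longrightarrow> lessA x z" "lessB x y \<Longrightarrow> lessB y z \<Longrightarrow> lessB x z"
    using r by (auto simp: strictly_before_def dest: transD antisymD)
  show "lessA x y \<Longrightarrow> \<not> lessA y x" "lessB x y \<Longrightarrow> \<not> lessB y x"
    using r by (auto simp: strictly_before_def dest: antisymD)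
  show "x \<in> A \<Longrightarrow> y \<in> A \<Longrightarrow> x \<noteq> y \<Longrightarrow> lessA x y \<or> lessA y x"
    "x \<in> B \<Longrightarrow> y \<in> B \<Longrightarrow> x \<noteq> y \<Longrightarrow> lessB x y \<or> lessB y x"
    using r by (auto simp: strictly_before_def total_on_def)
qed

lemma before_transp: "transp before"
proof (rule transpI)
  fix e f g assume "before e f" "before f g"
  then obtain v w x y x' y' z u where *: "v \<in> A" "w \<in> B" "x \<in> A" "y \<in> B" "z \<in> A" "u \<in> B"
    "x' \<in> A" "y' \<in> B" "e = {v, w}" "f = {x, y}" "f = {x', y'}" "g = {z, u}"
    "lessA v x" "lessB w y" "lessA x' z" "lessB y' u"
    unfolding before_def by metis
  then have "x' = x" "y' = y" using edge_eq_iff by metis+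
  then show "before e g" using * before_iff less_trans by metis
qed

lemma before_asymp: "asymp before"
proof (rule asympI)
  fix e f assume "before e f"
  then show "\<not> before f e" using before_iff less_asym unfolding before_def by metis
qed

lemma before_not_cross: "before e f \<Longrightarrow> \<not> cross e f \<and> \<not> cross f e"
  unfolding before_def using cross_iff less_asym by metis

lemma not_cross_self:
  assumes "e \<in> E"
  shows "\<not> cross e e"
proof -
  obtain v w where "v \<in> A" "w \<in> B" "e = {v, w}" using edge_form[OF assms] by blast
  then show ?thesis using cross_iff less_asym by metis
qed

lemma disjnt_cross_or_before:
  assumes "e \<in> E" "f \<in> E" "disjnt e f"
  shows "cross e f \<or> before e f \<or> before f e"
proof -
  obtain v w x y where *: "v \<in> A" "w \<in> B" "e = {v, w}" "x \<in> A" "y \<in> B" "f = {x, y}"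
    using edge_form[OF assms(1)] edge_form[OF assms(2)] by blast
  then have "v \<noteq> x" "w \<noteq> y" using assms(3) by (auto simp: disjnt_def)
  then show ?thesis using * less_total cross_iff before_iff by metis
qed

text \<open>An antichain of \<open>before\<close> inside \<open>M\<close> with \<open>k + 1\<close>
  edges would be a forbidden crossing, so \<open>chain_or_antichain\<close> yields a chain.\<close>

lemma non_crossing_submatching:
  assumes no_cross: "\<not> (\<exists>M. is_k_crossing E A B rA rB (k + 1) M)"
    and M: "matching E M" and card: "k * r < card M"
  shows "\<exists>N\<subseteq>M. card N = Suc r \<and> non_crossing A B rA rB N"
proof -
  have ME: "M \<subseteq> E" and disj: "pairwise disjnt M" using M by (auto simp: matching_def)
  have finM: "finite M" using ME finite_E finite_subset by blast
  have anti: "card N \<le> k" if N: "N \<subseteq> M" "\<forall>x\<in>N. \<forall>y\<in>N. \<not> before x y" for N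
  proof (rule ccontr)
    assume "\<not> card N \<le> k"
    then have "k + 1 \<le> card N" by simp
    then obtain S where S: "S \<subseteq> N" "card S = k + 1" "finite S"
      by (rule obtain_subset_with_card_n)
    have "pairwise cross S"
    proof (rule pairwiseI)
      fix e f assume "e \<in> S" "f \<in> S" "e \<noteq> f"
      moreover have "e \<in> M" "f \<in> M" using calculation S(1) N(1) by auto
      ultimately show "cross e f"
        using disjnt_cross_or_before[of e f] ME disj N(2) S(1)
        by (meson pairwiseD subsetD)
    qed
    then have "is_k_crossing E A B rA rB (k + 1) S"
      using S N(1) ME by (auto simp: is_k_crossing_def)
    then show False using no_cross by blast
  qed
  obtain N where N: "N \<subseteq> M" "card N = Suc r"
    "\<forall>x\<in>N. \<forall>y\<in>N. x = y \<or> before x y \<or> before y x"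
    using chain_or_antichain[OF finM before_transp before_asymp anti card] by blast
  have "non_crossing A B rA rB N"
    unfolding non_crossing_def
  proof (intro ballI)
    fix e f assume ef: "e \<in> N" "f \<in> N"
    \<comment> \<open>\<open>non_crossing\<close> also ranges over pairs of equal edges, hence the
      first case.\<close>
    then consider "e = f" | "before e f" | "before f e" using N(3) by blast
    then show "\<not> cross e f"
    proof cases
      case 1
      then show ?thesis using ef N(1) ME not_cross_self by blast
    qed (simp_all add: before_not_cross)
  qed
  then show ?thesis using N(1,2) by blast
qed

section \<open>Balanced sweep of the drawing\<close>

definition initial :: "'a set \<Rightarrow> bool" where
  "initial P \<longleftrightarrow> (\<forall>u\<in>A \<inter> P. \<forall>v\<in>A - P. lessA u v) \<and> (\<forall>u\<in>B \<inter> P. \<forall>v\<in>B - P. lessB u v)"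

abbreviation "cutA P \<equiv> matching_number E (A \<inter> P) (B - P)"

abbreviation "cutB P \<equiv> matching_number E (B \<inter> P) (A - P)"

text \<open>A cut edge has exactly one end in \<open>P\<close>, and the layer of that end splits the
  matching in two.\<close>

lemma card_cut_matching_le:
  assumes "M \<subseteq> cut_edges E P" "pairwise disjnt M"
  shows "card M \<le> cutA P + cutB P"
proof -
  define M1 where "M1 = {e \<in> M. \<exists>x\<in>A \<inter> P. \<exists>y\<in>B - P. e = {x, y}}"
  define M2 where "M2 = {e \<in> M. \<exists>x\<in>B \<inter> P. \<exists>y\<in>A - P. e = {x, y}}"
  have ME: "M \<subseteq> E" using assms(1) by (auto simp: cut_edges_def)
  have "e \<in> M1 \<union> M2" if e: "e \<in> M" for e
  proof -
    obtain v w where vw: "v \<in> A" "w \<in> B" "e = {v, w}" using edge_form e ME by blast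
    obtain x y where "x \<in> P" "y \<notin> P" "e = {x, y}" using e assms(1) by (auto simp: cut_edges_def)
    then have "v \<in> P \<and> w \<notin> P \<or> w \<in> P \<and> v \<notin> P" using vw(3) by (auto simp: doubleton_eq_iff)
    moreover have "e = {w, v}" using vw(3) by (simp add: insert_commute)
    ultimately show ?thesis using vw e unfolding M1_def M2_def by blast
  qed
  then have "M = M1 \<union> M2" by (auto simp: M1_def M2_def)
  then have "card M \<le> card M1 + card M2" using card_Un_le by metis
  moreover have "matching E M1" "matching E M2"
    using ME assms(2) by (auto simp: matching_def M1_def M2_def pairwise_def)
  then have "card M1 \<le> cutA P" "card M2 \<le> cutB P"
    using finite_E by (auto intro!: matching_number_ge simp: M1_def M2_def)
  ultimately show ?thesis by linarith
qed

lemma min_cut_le: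
  assumes no_cross: "\<not> (\<exists>M. is_k_crossing E A B rA rB (k + 1) M)"
    and no_st: "\<not> (\<exists>S T. is_st_crossing E A B rA rB s t S T)"
    and "s \<le> Suc r" "t \<le> Suc r" and P: "initial P"
  shows "min (cutA P) (cutB P) \<le> k * r"
proof (rule ccontr)
  assume "\<not> ?thesis"
  then have large: "k * r < cutA P" "k * r < cutB P" by auto
  \<comment> \<open>A non-crossing matching of \<open>Suc r\<close> edges is trimmed to the required
    size; this serves both sides of the cut.\<close>
  have sub: "\<exists>S. S \<subseteq> E \<and> matching E S \<and> finite S \<and> card S = s \<and> non_crossing A B rA rB S \<and>
      (\<forall>e\<in>S. \<exists>x\<in>X. \<exists>y\<in>Y. e = {x, y})"
    if s: "s \<le> Suc r" and l: "k * r < matching_number E X Y" for s X Y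
  proof -
    obtain M where M: "matching E M" "\<forall>e\<in>M. \<exists>x\<in>X. \<exists>y\<in>Y. e = {x, y}"
      "card M = matching_number E X Y"
      using matching_number_attained[OF finite_E] by metis
    obtain N where N: "N \<subseteq> M" "card N = Suc r" "non_crossing A B rA rB N"
      using non_crossing_submatching[OF no_cross M(1)] l M(3) by auto
    obtain S where S: "S \<subseteq> N" "card S = s" "finite S"
      using obtain_subset_with_card_n[of s N] s N(2) by metis
    have "matching E S" using M(1) N(1) S(1) by (auto simp: matching_def intro: pairwise_subset)
    moreover have "non_crossing A B rA rB S" using N(3) S(1) by (auto simp: non_crossing_def)
    ultimately show ?thesis using S N(1) M(2) by (intro exI[of _ S]) (auto simp: matching_def)
  qed
  obtain S where S: "matching E S" "finite S" "card S = s" "non_crossing A B rA rB S"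
    "\<forall>e\<in>S. \<exists>x\<in>A \<inter> P. \<exists>y\<in>B - P. e = {x, y}"
    using sub[OF assms(3) large(1)] by blast
  obtain T where T: "matching E T" "finite T" "card T = t" "non_crossing A B rA rB T"
    "\<forall>e\<in>T. \<exists>x\<in>B \<inter> P. \<exists>y\<in>A - P. e = {x, y}"
    using sub[OF assms(4) large(2)] by blast
  have "cross e f" if "e \<in> S" "f \<in> T" for e f
  proof -
    obtain v w where vw: "v \<in> A \<inter> P" "w \<in> B - P" "e = {v, w}" using S(5) \<open>e \<in> S\<close> by blast
    obtain x y where xy: "x \<in> A - P" "y \<in> B \<inter> P" "f = {x, y}"
      using T(5) \<open>f \<in> T\<close> by (metis insert_commute)
    \<comment> \<open>In each layer the end inside the initial set comes first: that of
      \<open>e\<close> in \<open>A\<close>, that of \<open>f\<close> in \<open>B\<close>.\<close>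
    have "lessA v x" "lessB y w" using P vw xy by (auto simp: initial_def)
    then show ?thesis using vw xy cross_iff by auto
  qed
  then have "is_st_crossing E A B rA rB s t S T" using S T by (auto simp: is_st_crossing_def)
  then show False using no_st by blast
qed

lemma initial_insert:
  assumes "initial P"
  shows "v \<in> A - P \<Longrightarrow> (\<And>u. u \<in> A - P \<Longrightarrow> u \<noteq> v \<Longrightarrow> lessA v u) \<Longrightarrow> initial (insert v P)"
    and "v \<in> B - P \<Longrightarrow> (\<And>u. u \<in> B - P \<Longrightarrow> u \<noteq> v \<Longrightarrow> lessB v u) \<Longrightarrow> initial (insert v P)"
  using assms disjoint unfolding initial_def by blast+

text \<open>A new vertex of \<open>B\<close> lowers \<open>cutA\<close> and raises
  \<open>cutB\<close>, each by at most 1, and a new vertex of \<open>A\<close> does the reverse.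
  Moving against the sign of \<open>cutA P - cutB P\<close> therefore keeps the difference between
  -2 and 2.\<close>

lemma balanced_extension:
  assumes "initial P" "P \<subset> V" "cutA P \<le> cutB P + 2" "cutB P \<le> cutA P + 2"
  shows "\<exists>v\<in>V - P. initial (insert v P) \<and>
    cutA (insert v P) \<le> cutB (insert v P) + 2 \<and> cutB (insert v P) \<le> cutA (insert v P) + 2"
proof -
  have finA: "finite (A - P)" and finB: "finite (B - P)" using finite_V V_eq by auto
  note empty = matching_number_empty[OF finite_E]
  have emptyA: "cutA P = 0" if "B - P = {}"
    using that empty matching_number_commute by metis
  have emptyB: "cutB P = 0" if "A - P = {}" for P
    using that empty matching_number_commute by metis
  show ?thesis
  proof (cases "cutB P < cutA P \<or> A - P = {}")
    case True
    then have "B - P \<noteq> {}" using emptyA assms(2) V_eq by auto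
    then obtain v where v: "v \<in> B - P" "\<And>u. u \<in> B - P \<Longrightarrow> u \<noteq> v \<Longrightarrow> lessB v u"
      using linear_order_least[OF order_B _ finB] by blast
    have "v \<notin> A" using v disjoint by auto
    note move = matching_number_move[OF finite_E v(1) this]
    have "cutA (insert v P) \<le> cutB (insert v P) + 2 \<and> cutB (insert v P) \<le> cutA (insert v P) + 2"
    proof (cases "A - P = {}")
      \<comment> \<open>With \<open>A\<close> used up the choice is forced, but \<open>cutB\<close>
        stays 0 and \<open>cutA\<close>, at most 2, cannot grow.\<close>
      case True
      then have "cutB P = 0" "cutB (insert v P) = 0" by (auto intro!: emptyB)
      then show ?thesis using move assms(3) by linarith
    next
      case False
      then show ?thesis using True move assms(3,4) by linarith
    qed
    then show ?thesis using initial_insert(2)[OF assms(1) v] v(1) V_eq by blast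
  next
    case False
    then obtain v where v: "v \<in> A - P" "\<And>u. u \<in> A - P \<Longrightarrow> u \<noteq> v \<Longrightarrow> lessA v u"
      using linear_order_least[OF order_A _ finA] by blast
    have "v \<notin> B" using v disjoint by auto
    note move = matching_number_move[OF finite_E v(1) this]
    have "cutA (insert v P) \<le> cutB (insert v P) + 2 \<and> cutB (insert v P) \<le> cutA (insert v P) + 2"
      using False move assms(3,4) by linarith
    then show ?thesis using initial_insert(1)[OF assms(1) v] v(1) V_eq by blast
  qed
qed

lemma pathwidth_drawing_le:
  assumes no_cross: "\<not> (\<exists>M. is_k_crossing E A B rA rB (k + 1) M)"
    and no_st: "\<not> (\<exists>S T. is_st_crossing E A B rA rB s t S T)"
    and "s \<le> Suc r" "t \<le> Suc r"
  shows "pathwidth V E \<le> 4 * int k * int r + 4"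
proof -
  let ?Q = "\<lambda>P. initial P \<and> cutA P \<le> cutB P + 2 \<and> cutB P \<le> cutA P + 2"
  have "?Q {}" using matching_number_empty[OF finite_E] by (simp add: initial_def)
  then obtain vs where vs: "distinct vs" "set vs = V" "\<forall>i\<le>length vs. ?Q (set (take i vs))"
    using ordering_by_extension[OF finite_V, of ?Q] balanced_extension by blast
  \<comment> \<open>The smaller cut number is at most \<open>k * r\<close> and the other exceeds it
    by at most 2.\<close>
  have "card M \<le> 2 * (k * r + 1)"
    if "i \<le> length vs" "M \<subseteq> cut_edges E (set (take i vs))" "pairwise disjnt M" for i M
    using card_cut_matching_le[OF that(2,3)] vs(3) that(1)
      min_cut_le[OF assms, of "set (take i vs)"] by fastforce
  then have "pathwidth V E \<le> 2 * int (2 * (k * r + 1))"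
    by (rule pathwidth_le_of_ordering[OF graph vs(1,2)])
  then show ?thesis by simp
qed

end

section \<open>Comparison with the stated bound\<close>

theorem theorem2:
  fixes V :: "'a set" and E :: "'a set set"
    and A B :: "'a set" and rA rB :: "'a rel"
    and k s t :: nat
  assumes "k \<ge> 1" and "s \<ge> 1" and "t \<ge> 1"
    and "finite_simple_graph V E"
    and "two_layer_drawing V E A B rA rB"
    and "\<not> (\<exists>M. is_k_crossing E A B rA rB (k + 1) M)"
    and "\<not> (\<exists>S T. is_st_crossing E A B rA rB s t S T)"
  shows "pathwidth V E \<le>
    8 * (int k)\<^sup>2 * (int t - 1) + 4 * (int k)\<^sup>2 * (int s - 1)\<^sup>2 * (int s - 2) + 5 * int k + 4"
proof -
  interpret drawing V E A B rA rB using assms(4,5) by unfold_locales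
  define r where "r = max s t - 1"
  have pw: "pathwidth V E \<le> 4 * int k * int r + 4"
    using assms(2,3) by (intro pathwidth_drawing_le[OF assms(6,7)]) (auto simp: r_def)
  have kk: "int k \<le> (int k)\<^sup>2" using assms(1) by (simp add: power2_eq_square)
  have t: "4 * int k * (int t - 1) \<le> 8 * (int k)\<^sup>2 * (int t - 1)"
  proof (rule mult_right_mono)
    show "4 * int k \<le> 8 * (int k)\<^sup>2" using kk by linarith
  qed (use assms(3) in simp)
  show ?thesis
  proof (cases "s \<le> 2")
    case True
    then have "s = 1 \<or> s = 2" using assms(2) by auto
    \<comment> \<open>One factor vanishes for each of the two values of \<open>s\<close>, so the
      terms in \<open>t\<close> and \<open>k\<close> must suffice.\<close>
    then have z: "4 * (int k)\<^sup>2 * (int s - 1)\<^sup>2 * (int s - 2) = 0" by auto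
    \<comment> \<open>Only for \<open>t = 1\<close> and \<open>s = 2\<close> does \<open>r\<close>
      exceed \<open>t - 1\<close>; the resulting extra \<open>4 * k\<close> is absorbed by
      \<open>5 * k\<close>.\<close>
    have "int r \<le> int t - 1 + (if t = 1 then 1 else 0)"
      using True assms(3) by (auto simp: r_def)
    then have "4 * int k * int r \<le> 4 * int k * (int t - 1 + (if t = 1 then 1 else 0))"
      by (intro mult_left_mono) auto
    then have "4 * int k * int r \<le> 4 * int k * (int t - 1) + 4 * int k"
      by (auto simp: algebra_simps split: if_splits)
    then show ?thesis using pw t z by linarith
  next
    case False
    \<comment> \<open>For \<open>s\<close> at least 3 the cubic term dominates
      \<open>4 * k * (s - 1)\<close>, and \<open>r\<close> is at most
      \<open>(s - 1) + (t - 1)\<close>.\<close>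
    have "int s - 1 \<le> (int s - 1)\<^sup>2 * (int s - 2)"
    proof -
      have "0 < (int s - 1) * (int s - 2)" using False by (intro mult_pos_pos) auto
      then have "1 \<le> (int s - 1) * (int s - 2)" by linarith
      then have "(int s - 1) * 1 \<le> (int s - 1) * ((int s - 1) * (int s - 2))"
        by (rule mult_left_mono) (use False in simp)
      then show ?thesis by (simp add: power2_eq_square mult.assoc)
    qed
    then have "(int k * 4) * (int s - 1) \<le> ((int k)\<^sup>2 * 4) * ((int s - 1)\<^sup>2 * (int s - 2))"
      using kk False by (intro mult_mono) auto
    moreover have "4 * int k * int r \<le> 4 * int k * ((int s - 1) + (int t - 1))"
      using assms(2,3) by (intro mult_left_mono) (auto simp: r_def)
    ultimately show ?thesis using pw t by (simp add: algebra_simps)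
  qed
qed

end
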